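(* Let $N\ge0$ be an integer and $\rho_2>\rho_1>0$. If we choose $N^*=N$ and $p_i=2i$ for $i=0,1,\dots,N^*$, or $N^*=2N$ and $p_i=i$ for $i=0,1,\dots,N^*$, then for any $\boldsymbol\xi\in\mathbf R^n$ and any $h_1,h_2,g>0$ we have $$\left|\left(\frac{c_{\rm IW}(\boldsymbol\xi)}{c_{\rm SW}}\right)^2-\left(\frac{c_{\rm K}(\boldsymbol\xi)}{c_{\rm SW}}\right)^2\right|\le C(h_1|\boldsymbol\xi|+h_2|\boldsymbol\xi|)^{4N+2},$$ where $C$ is a positive constant depending only on $N$.
   Context: $\rho_1,\rho_2$ are the densities of the upper and lower layers, $h_1,h_2$ the mean thicknesses, $g$ the gravitational constant. Define $$c_{\rm IW}(\boldsymbol\xi)^2=\frac{(\rho_2-\rho_1)g}{\rho_1|\boldsymbol\xi|\coth(h_1|\boldsymbol\xi|)+\rho_2|\boldsymbol\xi|\coth(h_2|\boldsymbol\xi|)},\qquad c_{\rm SW}^2=\frac{(\rho_2-\rho_1)gh_1h_2}{\rho_1h_2+\rho_2h_1}.$$ For integers $0=p_0<\dots<p_{N^*}$, with the convention $\frac00=0$ for matrix entries, set $A_{1,0}=\bigl(\frac1{2(i+j)+1}\bigr)_{0\le i,j\le N}$, $A_{1,1}=\bigl(\frac{4ij}{2(i+j)-1}\bigr)_{0\le i,j\le N}$, $A_{2,0}=\bigl(\frac1{p_i+p_j+1}\bigr)_{0\le i,j\le N^*}$, $A_{2,1}=\bigl(\frac{p_ip_j}{p_i+p_j-1}\bigr)_{0\le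 i,j\le N^*}$, $\mathcal A_k(\boldsymbol\xi)=|\boldsymbol\xi|^2A_{k,0}+A_{k,1}$ for $k=1,2$, and for a square matrix $\mathcal A$ put $\tilde{\mathcal A}=\begin{pmatrix}0&\boldsymbol1^{\rm T}\\-\boldsymbol1&\mathcal A\end{pmatrix}$ with $\boldsymbol1=(1,\dots,1)^{\rm T}$. The phase speed of the Kakinuma model linearized about rest is $$c_{\rm K}(\boldsymbol\xi)^2=\frac{(\rho_2-\rho_1)g|\boldsymbol\xi|^{-2}\det\mathcal A_1(h_1\boldsymbol\xi)\det\mathcal A_2(h_2\boldsymbol\xi)}{\rho_1h_1\det\tilde{\mathcal A}_1(h_1\boldsymbol\xi)\det\mathcal A_2(h_2\boldsymbol\xi)+\rho_2h_2\det\tilde{\mathcal A}_2(h_2\boldsymbol\xi)\det\mathcal A_1(h_1\boldsymbol\xi)}.$$ At $\boldsymbol\xi=\boldsymbol0$, $c_{\rm IW}^2$ and $c_{\rm K}^2$ are understood as their continuous extensions. *)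

theory Defs
  imports
    "HOL-Analysis.Abstract_Euclidean_Space"
    "HOL-Analysis.L2_Norm"
    "Jordan_Normal_Form.Determinant"
begin

text \<open>
  The constant of the theorem must not depend on the dimension of the horizontal space, so
  \<open>n\<close>-dimensional real space is the topological space \<^const>\<open>Euclidean_space\<close>\<open> n\<close>, whose points are the
  functions \<open>nat \<Rightarrow> real\<close> vanishing at all indices from \<open>n\<close> on, rather than a type.
\<close>

definition euclid_norm :: "nat \<Rightarrow> (nat \<Rightarrow> real) \<Rightarrow> real" where
  "euclid_norm n \<xi> = L2_set \<xi> {..<n}"

definition cont_extension_at_origin ::
    "nat \<Rightarrow> ((nat \<Rightarrow> real) \<Rightarrow> real) \<Rightarrow> (nat \<Rightarrow> real) \<Rightarrow> real" where
  "cont_extension_at_origin n f \<xi> =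
     (if \<xi> = (\<lambda>_. 0) then Lim (atin (Euclidean_space n) (\<lambda>_. 0)) f else f \<xi>)"

definition coth :: "real \<Rightarrow> real" where
  "coth x = cosh x / sinh x"

definition c_IW_sq ::
    "nat \<Rightarrow> real \<Rightarrow> real \<Rightarrow> real \<Rightarrow> real \<Rightarrow> real \<Rightarrow> (nat \<Rightarrow> real) \<Rightarrow> real" where
  "c_IW_sq n \<rho>1 \<rho>2 h1 h2 g = cont_extension_at_origin n (\<lambda>\<xi>. let k = euclid_norm n \<xi> in
     (\<rho>2 - \<rho>1) * g / (\<rho>1 * k * coth (h1 * k) + \<rho>2 * k * coth (h2 * k)))"

definition c_SW_sq :: "real \<Rightarrow> real \<Rightarrow> real \<Rightarrow> real \<Rightarrow> real \<Rightarrow> real" where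
  "c_SW_sq \<rho>1 \<rho>2 h1 h2 g = (\<rho>2 - \<rho>1) * g * h1 * h2 / (\<rho>1 * h2 + \<rho>2 * h1)"

text \<open>
  In the matrices below, the convention that \<open>0/0\<close> is \<open>0\<close> is the one of division in HOL; the
  subtractions in the denominators are on the reals.
\<close>

definition A10 :: "nat \<Rightarrow> real mat" where
  "A10 N = mat (N + 1) (N + 1) (\<lambda>(i, j). 1 / (2 * (real i + real j) + 1))"

definition A11 :: "nat \<Rightarrow> real mat" where
  "A11 N = mat (N + 1) (N + 1)
     (\<lambda>(i, j). 4 * real i * real j / (2 * (real i + real j) - 1))"

definition A20 :: "nat \<Rightarrow> (nat \<Rightarrow> nat) \<Rightarrow> real mat" where
  "A20 Nstar p = mat (Nstar + 1) (Nstar + 1) (\<lambda>(i, j). 1 / (real (p i) + real (p j) + 1))"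

definition A21 :: "nat \<Rightarrow> (nat \<Rightarrow> nat) \<Rightarrow> real mat" where
  "A21 Nstar p = mat (Nstar + 1) (Nstar + 1)
     (\<lambda>(i, j). real (p i) * real (p j) / (real (p i) + real (p j) - 1))"

definition calA1 :: "nat \<Rightarrow> nat \<Rightarrow> (nat \<Rightarrow> real) \<Rightarrow> real mat" where
  "calA1 n N \<xi> = (euclid_norm n \<xi>)\<^sup>2 \<cdot>\<^sub>m A10 N + A11 N"

definition calA2 :: "nat \<Rightarrow> nat \<Rightarrow> (nat \<Rightarrow> nat) \<Rightarrow> (nat \<Rightarrow> real) \<Rightarrow> real mat" where
  "calA2 n Nstar p \<xi> = (euclid_norm n \<xi>)\<^sup>2 \<cdot>\<^sub>m A20 Nstar p + A21 Nstar p"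

definition bordered :: "real mat \<Rightarrow> real mat" where
  "bordered A = four_block_mat
     (0\<^sub>m 1 1)                      (mat 1 (dim_col A) (\<lambda>_. 1))
     (mat (dim_row A) 1 (\<lambda>_. - 1)) A"

definition c_K_sq ::
    "nat \<Rightarrow> nat \<Rightarrow> nat \<Rightarrow> (nat \<Rightarrow> nat) \<Rightarrow> real \<Rightarrow> real \<Rightarrow> real \<Rightarrow> real \<Rightarrow> real \<Rightarrow> (nat \<Rightarrow> real) \<Rightarrow> real"
  where
  "c_K_sq n N Nstar p \<rho>1 \<rho>2 h1 h2 g = cont_extension_at_origin n (\<lambda>\<xi>.
     let M1 = calA1 n N (\<lambda>i. h1 * \<xi> i); M2 = calA2 n Nstar p (\<lambda>i. h2 * \<xi> i) in
     (\<rho>2 - \<rho>1) * g * inverse ((euclid_norm n \<xi>)\<^sup>2) * det M1 * det M2 /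
     (\<rho>1 * h1 * det (bordered M1) * det M2 + \<rho>2 * h2 * det (bordered M2) * det M1))"

end

theory Submission
  imports Defs "HOL-Analysis.Equivalence_Lebesgue_Henstock_Integration"
begin

text \<open>
  The matrix \<open>\<A>\<^sub>k(x)\<close> is the Gram matrix of the energy \<open>E(f) = \<integral>\<^sub>0\<^sup>1 x\<^sup>2 f\<^sup>2 + f'\<^sup>2\<close> on the span of
  the monomials \<open>z\<^bsup>p\<^sub>i\<^esup>\<close>, and by a Schur complement the ratio of the bordered determinant to
  the plain one is \<open>R = 1\<^sup>T \<A>\<^sup>-\<^sup>1 1\<close>, the Galerkin approximation of \<open>u(1)\<close>, where
  \<open>u(z) = cosh (x z) / (x sinh x)\<close> solves \<open>u'' = x\<^sup>2 u\<close>, \<open>u'(0) = 0\<close>, \<open>u'(1) = 1\<close>.  As \<open>u(1) = coth x / x\<close>,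
  \<open>u(1) - R\<close> is the minimum of \<open>E(u - f)\<close> over the span.  Inserting for \<open>f\<close> the Taylor polynomial
  of \<open>u\<close> of degree \<open>2N\<close>, which lies in the span for both choices of exponents, gives
  \<open>0 \<le> x coth x - x\<^sup>2 R \<le> C x\<^bsup>4N+2\<^esup>\<close>.  The squared phase speeds are \<open>(\<rho>\<^sub>2 - \<rho>\<^sub>1) g\<close> divided by weighted
  sums of \<open>x coth x\<close> and of \<open>x\<^sup>2 R\<close> respectively, at \<open>x = h\<^sub>1|\<xi>|\<close> and \<open>x = h\<^sub>2|\<xi>|\<close>, with weights
  \<open>\<rho>\<^sub>i/h\<^sub>i\<close>; since both functions are at least 1, the estimate carries over.
\<close>

subsection \<open>Gram matrix of the energy\<close>

text \<open>Schur complement: adding the columns of \<open>G\<close>, weighted by the solution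
  \<open>v\<close> of \<open>G v = 1\<close>, to the border column makes the matrix block triangular
  with the sum of \<open>v\<close> in the corner. The linear system is kept in the conclusion
  because the variational arguments need only it, not the inverse of \<open>G\<close>.\<close>

lemma bordered_ratio:
  fixes G :: "real mat"
  assumes G: "G \<in> carrier_mat (M + 1) (M + 1)" and d: "det G \<noteq> 0"
  obtains v where "\<And>i. i \<le> M \<Longrightarrow> (\<Sum>j\<le>M. G $$ (i, j) * v j) = 1"
    and "det (bordered G) / det G = (\<Sum>i\<le>M. v i)"
proof -
  let ?n = "M + 1"
  from det_non_zero_imp_unit[OF G d] obtain H
    where H: "H \<in> carrier_mat ?n ?n" and GH: "G * H = 1\<^sub>m ?n"
    by (auto simp: Units_def ring_mat_def)
  define J where "J = mat ?n 1 (\<lambda>_. 1::real)"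
  define V where "V = H * J"
  define v where "v = (\<lambda>j. V $$ (j, 0))"
  have J: "J \<in> carrier_mat ?n 1" by (simp add: J_def)
  have V: "V \<in> carrier_mat ?n 1" using H J by (simp add: V_def)
  have GV: "G * V = J"
    using assoc_mult_mat[OF G H J] GH J by (simp add: V_def)
  have rows: "(\<Sum>j\<le>M. G $$ (i, j) * v j) = 1" if "i \<le> M" for i
  proof -
    have "(G * V) $$ (i, 0) = (\<Sum>j\<le>M. G $$ (i, j) * v j)"
      using G V that
      by (simp add: scalar_prod_def v_def atLeast0LessThan lessThan_Suc_atMost)
    moreover have "(G * V) $$ (i, 0) = 1"
      using that unfolding GV by (simp add: J_def)
    ultimately show ?thesis by simp
  qed
  define r where "r = mat 1 ?n (\<lambda>_. 1::real)"
  \<comment> \<open>Column operation clearing the block \<open>-1\<close> of the bordered matrix.\<close>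
  define K where "K = four_block_mat (1\<^sub>m 1) (0\<^sub>m 1 ?n) V (1\<^sub>m ?n)"
  have r: "r \<in> carrier_mat 1 ?n" by (simp add: r_def)
  have B: "bordered G = four_block_mat (0\<^sub>m 1 1) r (- J) G"
    using G unfolding bordered_def r_def J_def
    by (intro arg_cong3[where f = "\<lambda>x y z. four_block_mat (0\<^sub>m 1 1) x y z"] eq_matI) auto
  have JG: "- J + G * V = 0\<^sub>m ?n 1"
    unfolding GV using J by simp
  have "bordered G * K = four_block_mat (r * V) r (0\<^sub>m ?n 1) G"
    unfolding B K_def
    using mult_four_block_mat[of "0\<^sub>m 1 1" 1 1 r ?n "- J" ?n G "1\<^sub>m 1" 1 "0\<^sub>m 1 ?n" ?n V "1\<^sub>m ?n"]
      G J r V JG by simp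
  moreover have "det K = 1"
    unfolding K_def
    using det_four_block_mat_upper_right_zero[of "1\<^sub>m 1 :: real mat" 1 _ ?n V "1\<^sub>m ?n"] V by simp
  moreover have "det (bordered G * K) = det (bordered G) * det K"
    by (rule det_mult[of _ "?n + 1"]) (use G V in \<open>auto simp: bordered_def K_def\<close>)
  moreover have "det (four_block_mat (r * V) r (0\<^sub>m ?n 1) G) = det (r * V) * det G"
    using det_four_block_mat_lower_left_zero[of "r * V" 1 r ?n _ G] r V G by simp
  moreover have "det (r * V) = (\<Sum>i\<le>M. v i)"
  proof -
    have "det (r * V) = (r * V) $$ (0, 0)"
      by (rule det_single) (use r V in auto)
    also have "\<dots> = (\<Sum>i\<le>M. v i)"
      using V by (simp add: r_def scalar_prod_def v_def atLeast0LessThan lessThan_Suc_atMost)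
    finally show ?thesis .
  qed
  ultimately have "det (bordered G) / det G = (\<Sum>i\<le>M. v i)"
    using d by simp
  with rows show thesis by (rule that)
qed

section \<open>Trial functions and their energy\<close>

definition trial :: "(nat \<Rightarrow> nat) \<Rightarrow> nat \<Rightarrow> (nat \<Rightarrow> real) \<Rightarrow> real \<Rightarrow> real" where
  "trial p M c z = (\<Sum>i\<le>M. c i * z ^ p i)"

text \<open>For \<open>p i = 0\<close> the exponent \<open>p i - 1\<close> truncates to 0, but the
  factor \<open>real (p i)\<close> removes the term.\<close>

definition trial_deriv :: "(nat \<Rightarrow> nat) \<Rightarrow> nat \<Rightarrow> (nat \<Rightarrow> real) \<Rightarrow> real \<Rightarrow> real" where
  "trial_deriv p M c z = (\<Sum>i\<le>M. c i * (real (p i) * z ^ (p i - 1)))"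

text \<open>One matrix serves both layers: \<open>calA1\<close> is the case of the exponents
  \<open>2 * i\<close>. The number \<open>x\<close> stands for layer thickness times wave
  number.\<close>

definition gram :: "real \<Rightarrow> nat \<Rightarrow> (nat \<Rightarrow> nat) \<Rightarrow> real mat" where
  "gram x M p = x\<^sup>2 \<cdot>\<^sub>m A20 M p + A21 M p"

lemma gram_carrier: "gram x M p \<in> carrier_mat (M + 1) (M + 1)"
  by (simp add: gram_def A20_def A21_def)

lemma gram_index:
  assumes "i \<le> M" "j \<le> M"
  shows "gram x M p $$ (i, j) = x\<^sup>2 * (1 / (real (p i) + real (p j) + 1))
    + real (p i) * real (p j) / (real (p i) + real (p j) - 1)"
  using assms by (simp add: gram_def A20_def A21_def)

lemma gram_sym: "i \<le> M \<Longrightarrow> j \<le> M \<Longrightarrow> gram x M p $$ (i, j) = gram x M p $$ (j, i)"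
  by (simp add: gram_index add.commute mult.commute)

lemma has_integral_power_unit_interval:
  "((\<lambda>z::real. z ^ n) has_integral 1 / (real n + 1)) {0..1}"
proof -
  have "((\<lambda>z::real. z ^ n) has_integral (1 ^ (n + 1) / (real n + 1) - 0 ^ (n + 1) / (real n + 1))) {0..1}"
    by (rule fundamental_theorem_of_calculus)
      (auto simp: has_real_derivative_iff_has_vector_derivative[symmetric]
         intro!: derivative_eq_intros simp del: power_Suc simp: add.commute[of 1])
  then show ?thesis by simp
qed

text \<open>If an exponent is 0, the product of derivatives vanishes and so does the last fraction;
  for the exponents 0 and 1 this is the convention that 0/0 is 0. Otherwise the subtractions in the
  exponents are not truncated.\<close>

lemma monomial_energy:
  "((\<lambda>z. x\<^sup>2 * (z ^ a * z ^ b) + (real a * z ^ (a - 1)) * (real b * z ^ (b - 1)))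
     has_integral x\<^sup>2 * (1 / (real a + real b + 1)) + real a * real b / (real a + real b - 1)) {0..1}"
proof (cases "a = 0 \<or> b = 0")
  case True
  then show ?thesis
    using has_integral_mult_right[OF has_integral_power_unit_interval[of "a + b"], of "x\<^sup>2"]
    by (auto simp: power_add)
next
  case False
  then have "real (a - 1 + (b - 1)) + 1 = real a + real b - 1"
    by (auto simp: of_nat_diff)
  moreover have "z ^ (a - 1 + (b - 1)) = z ^ (a - 1) * z ^ (b - 1)" for z :: real
    by (rule power_add)
  ultimately show ?thesis
    using has_integral_add
      [OF has_integral_mult_right[OF has_integral_power_unit_interval[of "a + b"], of "x\<^sup>2"]
          has_integral_mult_right[OF has_integral_power_unit_interval[of "a - 1 + (b - 1)"], of "real a * real b"]]
    by (simp only: power_add[of _ a b] of_nat_add) (simp only: mult_ac times_divide_eq_left times_divide_eq_right mult_1)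
qed

lemma trial_energy:
  "((\<lambda>z. x\<^sup>2 * (trial p M c z)\<^sup>2 + (trial_deriv p M c z)\<^sup>2)
     has_integral (\<Sum>i\<le>M. \<Sum>j\<le>M. c i * c j * gram x M p $$ (i, j))) {0..1}"
proof -
  have "x\<^sup>2 * (trial p M c z)\<^sup>2 + (trial_deriv p M c z)\<^sup>2 =
     (\<Sum>i\<le>M. \<Sum>j\<le>M. c i * c j * (x\<^sup>2 * (z ^ p i * z ^ p j)
        + (real (p i) * z ^ (p i - 1)) * (real (p j) * z ^ (p j - 1))))" for z
    unfolding trial_def trial_deriv_def power2_eq_square[of "sum _ _"] sum_product
    by (simp add: sum_distrib_left sum.distrib algebra_simps)
  moreover have "((\<lambda>z. \<Sum>i\<le>M. \<Sum>j\<le>M. c i * c j * (x\<^sup>2 * (z ^ p i * z ^ p j)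
        + (real (p i) * z ^ (p i - 1)) * (real (p j) * z ^ (p j - 1))))
      has_integral (\<Sum>i\<le>M. \<Sum>j\<le>M. c i * c j * gram x M p $$ (i, j))) {0..1}"
    by (intro has_integral_sum) (auto simp only: gram_index atMost_iff finite_atMost intro!: has_integral_mult_right monomial_energy)
  ultimately show ?thesis by simp
qed

lemma gram_quadratic_form_nonneg:
  "0 \<le> (\<Sum>i\<le>M. \<Sum>j\<le>M. c i * c j * gram x M p $$ (i, j))"
  by (rule has_integral_nonneg[OF trial_energy]) auto

text \<open>A polynomial vanishing on an interval has infinitely many roots, so it is zero; by
  injectivity of \<open>p\<close> its coefficient of degree \<open>p k\<close> is \<open>c k\<close>
  alone.\<close>

lemma trial_eq_0D:
  assumes inj: "inj_on p {..M}" and zero: "\<And>z. z \<in> {0..1} \<Longrightarrow> trial p M c z = 0" and "k \<le> M"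
  shows "c k = 0"
proof -
  define P where "P = (\<Sum>i\<le>M. monom (c i) (p i))"
  have "poly P z = trial p M c z" for z
    by (simp add: P_def trial_def poly_sum poly_monom)
  then have "{0..1} \<subseteq> {z. poly P z = 0}"
    using zero by auto
  then have "infinite {z. poly P z = 0}"
    by (rule infinite_super) (simp add: infinite_Icc)
  then have "P = 0"
    using poly_roots_finite by blast
  then have "0 = coeff P (p k)" by simp
  also have "\<dots> = (\<Sum>i\<le>M. if i = k then c i else 0)"
    unfolding P_def coeff_sum coeff_monom
    using inj \<open>k \<le> M\<close> by (intro sum.cong) (auto dest: inj_onD)
  also have "\<dots> = c k" using \<open>k \<le> M\<close> by simp
  finally show ?thesis by simp
qed

text \<open>A kernel vector would be the coefficient vector of a trial function of zero energy. As
  \<open>x > 0\<close>, this function vanishes on the unit interval, and the monomials are linearly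
  independent there.\<close>

lemma det_gram_nonzero:
  assumes inj: "inj_on p {..M}" and x: "x > 0"
  shows "det (gram x M p) \<noteq> 0"
proof
  let ?G = "gram x M p"
  assume "det ?G = 0"
  then obtain w where w: "w \<in> carrier_vec (M + 1)" "w \<noteq> 0\<^sub>v (M + 1)" "?G *\<^sub>v w = 0\<^sub>v (M + 1)"
    using det_0_iff_vec_prod_zero_field[OF gram_carrier] by blast
  define c where "c = vec_index w"
  have row: "(\<Sum>j\<le>M. ?G $$ (i, j) * c j) = 0" if "i \<le> M" for i
  proof -
    have "vec_index (?G *\<^sub>v w) i = (\<Sum>j\<le>M. ?G $$ (i, j) * c j)"
      using that w(1) gram_carrier[of x M p]
      by (simp add: scalar_prod_def c_def atLeast0LessThan lessThan_Suc_atMost)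
    then show ?thesis using w(3) that by simp
  qed
  have "(\<Sum>i\<le>M. \<Sum>j\<le>M. c i * c j * ?G $$ (i, j)) = (\<Sum>i\<le>M. c i * (\<Sum>j\<le>M. ?G $$ (i, j) * c j))"
    by (simp add: sum_distrib_left mult_ac)
  also have "\<dots> = 0" by (simp add: row)
  finally have "((\<lambda>z. x\<^sup>2 * (trial p M c z)\<^sup>2 + (trial_deriv p M c z)\<^sup>2) has_integral 0) (cbox 0 1)"
    using trial_energy[of x p M c] by simp
  \<comment> \<open>A continuous nonnegative integrand with integral 0 vanishes pointwise.\<close>
  then have "x\<^sup>2 * (trial p M c z)\<^sup>2 + (trial_deriv p M c z)\<^sup>2 = 0" if "z \<in> {0..1}" for z
    using that
    by (intro has_integral_0_cbox_imp_0[where a = 0 and b = 1])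
      (auto simp: trial_def trial_deriv_def intro!: continuous_intros)
  then have "trial p M c z = 0" if "z \<in> {0..1}" for z
    using x that by (fastforce simp: add_nonneg_eq_0_iff)
  then have "c k = 0" if "k \<le> M" for k
    using trial_eq_0D[OF inj _ that] by blast
  then have "w = 0\<^sub>v (M + 1)"
    using w(1) by (intro eq_vecI) (auto simp: c_def)
  with w(2) show False by simp
qed

subsection \<open>Energy of the Galerkin error\<close>

text \<open>With \<open>u(z) = cosh (x z) / (x sinh x)\<close> the integrand is the derivative of
  \<open>u'(z) z^m\<close>, because \<open>u'' = x^2 u\<close>; the boundary values are
  \<open>u'(0) = 0\<close> and \<open>u'(1) = 1\<close>.\<close>

lemma exact_energy_cross:
  fixes x :: real
  assumes x: "x > 0"
  shows "((\<lambda>z. x\<^sup>2 * (cosh (x * z) / (x * sinh x) * z ^ m) + sinh (x * z) / sinh x * (real m * z ^ (m - 1)))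
    has_integral 1) {0..1}"
proof -
  have "((\<lambda>z. x\<^sup>2 * (cosh (x * z) / (x * sinh x) * z ^ m) + sinh (x * z) / sinh x * (real m * z ^ (m - 1)))
    has_integral (sinh (x * 1) / sinh x * 1 ^ m - sinh (x * 0) / sinh x * 0 ^ m)) {0..1}"
    using x by (intro fundamental_theorem_of_calculus)
      (auto simp: has_real_derivative_iff_has_vector_derivative[symmetric] power2_eq_square
         add_divide_distrib mult_ac intro!: derivative_eq_intros)
  then show ?thesis using x by simp
qed

text \<open>The integrand is the derivative of \<open>u' u\<close>, so the integral is
  \<open>u'(1) u(1) = u(1)\<close>.\<close>

lemma exact_energy:
  fixes x :: real
  assumes x: "x > 0"
  shows "((\<lambda>z. x\<^sup>2 * (cosh (x * z) / (x * sinh x))\<^sup>2 + (sinh (x * z) / sinh x)\<^sup>2)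
    has_integral coth x / x) {0..1}"
proof -
  have "((\<lambda>z. x\<^sup>2 * (cosh (x * z) / (x * sinh x))\<^sup>2 + (sinh (x * z) / sinh x)\<^sup>2)
    has_integral (sinh (x * 1) / sinh x * (cosh (x * 1) / (x * sinh x))
      - sinh (x * 0) / sinh x * (cosh (x * 0) / (x * sinh x)))) {0..1}"
    using x by (intro fundamental_theorem_of_calculus)
      (auto simp: has_real_derivative_iff_has_vector_derivative[symmetric] power2_eq_square
         field_simps intro!: derivative_eq_intros)
  then show ?thesis using x by (simp add: coth_def mult.commute)
qed

text \<open>Expansion of the square: in the cross term every monomial contributes its value 1 at
  \<open>z = 1\<close>, whence the plain sum of the coefficients.\<close>

lemma error_energy:
  assumes x: "x > 0"
  shows "((\<lambda>z. x\<^sup>2 * (cosh (x * z) / (x * sinh x) - trial p M c z)\<^sup>2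
      + (sinh (x * z) / sinh x - trial_deriv p M c z)\<^sup>2)
    has_integral coth x / x - 2 * (\<Sum>i\<le>M. c i) + (\<Sum>i\<le>M. \<Sum>j\<le>M. c i * c j * gram x M p $$ (i, j))) {0..1}"
proof -
  let ?u = "\<lambda>z. cosh (x * z) / (x * sinh x)" and ?u' = "\<lambda>z. sinh (x * z) / sinh x"
  have eq: "(\<Sum>i\<le>M. c i * (x\<^sup>2 * (?u z * z ^ p i) + ?u' z * (real (p i) * z ^ (p i - 1))))
      = x\<^sup>2 * (?u z * trial p M c z) + ?u' z * trial_deriv p M c z" for z
    unfolding trial_def trial_deriv_def sum_distrib_left sum.distrib[symmetric]
    by (intro sum.cong refl) (simp add: algebra_simps)
  have "((\<lambda>z. \<Sum>i\<le>M. c i * (x\<^sup>2 * (?u z * z ^ p i) + ?u' z * (real (p i) * z ^ (p i - 1))))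
      has_integral (\<Sum>i\<le>M. c i * 1)) {0..1}"
    by (intro has_integral_sum finite_atMost has_integral_mult_right exact_energy_cross x)
  then have cross: "((\<lambda>z. x\<^sup>2 * (?u z * trial p M c z) + ?u' z * trial_deriv p M c z)
      has_integral (\<Sum>i\<le>M. c i)) {0..1}"
    unfolding eq by simp
  have "x\<^sup>2 * (a - t)\<^sup>2 + (a' - t')\<^sup>2
      = (x\<^sup>2 * a\<^sup>2 + a'\<^sup>2) - 2 * (x\<^sup>2 * (a * t) + a' * t') + (x\<^sup>2 * t\<^sup>2 + t'\<^sup>2)" for a a' t t' :: real
    by (simp add: power2_eq_square algebra_simps)
  then show ?thesis
    using has_integral_add[OF has_integral_diff[OF exact_energy[OF x]
        has_integral_mult_right[OF cross, of 2]] trial_energy[of x p M c]]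
    by simp
qed

text \<open>The factor \<open>x^2\<close> makes this the approximation of \<open>x * coth x\<close>,
  which tends to 1 at 0.\<close>

definition galerkin :: "real \<Rightarrow> nat \<Rightarrow> (nat \<Rightarrow> nat) \<Rightarrow> real" where
  "galerkin x M p = x\<^sup>2 * (det (bordered (gram x M p)) / det (gram x M p))"

text \<open>The Galerkin solution \<open>v\<close> minimizes the energy of the error, and the
  minimum is \<open>coth x / x - R\<close>. Its nonnegativity gives the upper bound; comparison with
  an arbitrary \<open>c\<close> gives the error estimate; comparison with a constant trial function
  gives the lower bound.\<close>

lemma galerkin_bounds:
  assumes inj: "inj_on p {..M}" and x: "x > 0"
  shows galerkin_le: "galerkin x M p \<le> x * coth x"
    and galerkin_error: "x * coth x - galerkin x M p \<le>
      x\<^sup>2 * (coth x / x - 2 * (\<Sum>i\<le>M. c i) + (\<Sum>i\<le>M. \<Sum>j\<le>M. c i * c j * gram x M p $$ (i, j)))"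
    and galerkin_ge: "p 0 = 0 \<Longrightarrow> 1 \<le> galerkin x M p"
proof -
  let ?G = "\<lambda>i j. gram x M p $$ (i, j)"
  let ?Q = "\<lambda>c. \<Sum>i\<le>M. \<Sum>j\<le>M. c i * c j * ?G i j"
  obtain v where row: "\<And>i. i \<le> M \<Longrightarrow> (\<Sum>j\<le>M. ?G i j * v j) = 1"
    and ratio: "det (bordered (gram x M p)) / det (gram x M p) = (\<Sum>i\<le>M. v i)"
    by (rule bordered_ratio[OF gram_carrier det_gram_nonzero[OF inj x]]) blast
  define R where "R = (\<Sum>i\<le>M. v i)"
  have cross: "(\<Sum>i\<le>M. \<Sum>j\<le>M. c i * v j * ?G i j) = (\<Sum>i\<le>M. c i)" for c
  proof -
    have "(\<Sum>i\<le>M. \<Sum>j\<le>M. c i * v j * ?G i j) = (\<Sum>i\<le>M. c i * (\<Sum>j\<le>M. ?G i j * v j))"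
      by (simp add: sum_distrib_left mult_ac)
    then show ?thesis by (simp add: row)
  qed
  have cross': "(\<Sum>i\<le>M. \<Sum>j\<le>M. v i * c j * ?G i j) = (\<Sum>i\<le>M. c i)" for c
  proof -
    have "(\<Sum>i\<le>M. \<Sum>j\<le>M. v i * c j * ?G i j) = (\<Sum>j\<le>M. \<Sum>i\<le>M. v i * c j * ?G i j)"
      by (rule sum.swap)
    also have "\<dots> = (\<Sum>i\<le>M. \<Sum>j\<le>M. c i * v j * ?G i j)"
      by (intro sum.cong refl) (simp add: gram_sym mult_ac)
    finally show ?thesis using cross by simp
  qed
  have Qv: "?Q v = R"
    using cross[of v] by (simp add: R_def)
  \<comment> \<open>\<open>v\<close> maximizes \<open>2 (1 \<bullet> c) - Q c\<close>, with maximal value \<open>R\<close>.\<close>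
  have key: "2 * (\<Sum>i\<le>M. c i) - ?Q c \<le> R" for c
  proof -
    have "0 \<le> ?Q (\<lambda>i. c i - v i)"
      by (rule gram_quadratic_form_nonneg)
    also have "?Q (\<lambda>i. c i - v i) = (\<Sum>i\<le>M. \<Sum>j\<le>M. c i * c j * ?G i j - c i * v j * ?G i j
        - v i * c j * ?G i j + v i * v j * ?G i j)"
      by (intro sum.cong refl) (simp add: algebra_simps)
    also have "\<dots> = ?Q c - 2 * (\<Sum>i\<le>M. c i) + R"
      by (simp add: sum.distrib sum_subtractf cross cross' R_def)
    finally show ?thesis by simp
  qed
  have gal: "galerkin x M p = x\<^sup>2 * R"
    by (simp add: galerkin_def ratio R_def)
  have xc: "x * coth x = x\<^sup>2 * (coth x / x)"
    using x by (simp add: power2_eq_square)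
  \<comment> \<open>This is the energy of the error at \<open>v\<close>; it equals
    \<open>coth x / x - R\<close> since \<open>?Q v = R\<close>.\<close>
  have "0 \<le> coth x / x - 2 * R + ?Q v"
    unfolding R_def by (rule has_integral_nonneg[OF error_energy[OF x]]) auto
  then have "R \<le> coth x / x"
    unfolding Qv by simp
  then show "galerkin x M p \<le> x * coth x"
    unfolding gal xc by (intro mult_left_mono) auto
  have "coth x / x - R \<le> coth x / x - 2 * (\<Sum>i\<le>M. c i) + ?Q c"
    using key[of c] by simp
  then have "x\<^sup>2 * (coth x / x - R) \<le> x\<^sup>2 * (coth x / x - 2 * (\<Sum>i\<le>M. c i) + ?Q c)"
    by (intro mult_left_mono) auto
  then show "x * coth x - galerkin x M p \<le> x\<^sup>2 * (coth x / x - 2 * (\<Sum>i\<le>M. c i) + ?Q c)"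
    unfolding gal xc by (simp add: right_diff_distrib)
  show "1 \<le> galerkin x M p" if p0: "p 0 = 0"
  proof -
    \<comment> \<open>The constant \<open>1 / x^2\<close> maximizes \<open>2 t - x^2 t^2\<close>
      over constant trial functions \<open>t\<close>; constants are available since
      \<open>p 0 = 0\<close>.\<close>
    let ?e = "\<lambda>i. if i = 0 then 1 / x\<^sup>2 else 0"
    have delta: "(\<Sum>i\<le>M. ?e i * f i) = 1 / x\<^sup>2 * f 0" for f
      by (simp add: if_distrib[of "\<lambda>t. t * _"] cong: if_cong)
    have "?Q ?e = (\<Sum>i\<le>M. ?e i * (\<Sum>j\<le>M. ?e j * ?G i j))"
      by (simp only: sum_distrib_left mult.assoc)
    also have "\<dots> = 1 / x\<^sup>2 * (1 / x\<^sup>2 * ?G 0 0)"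
      by (simp only: delta)
    also have "\<dots> = 1 / x\<^sup>2"
      using x by (simp add: gram_index p0)
    finally have "1 / x\<^sup>2 \<le> R"
      using key[of ?e] by simp
    then show ?thesis
      using x unfolding gal by (simp add: field_simps)
  qed
qed

section \<open>Taylor remainders of cosh and sinh\<close>

lemma cosh_sinh_derivs:
  "\<forall>m x. DERIV (if even m then cosh else sinh) x :> (if even (Suc m) then cosh else sinh) (x::real)"
  "\<forall>m x. DERIV (if even m then sinh else cosh) x :> (if even (Suc m) then sinh else cosh) (x::real)"
  by (auto intro!: derivative_eq_intros)

text \<open>The parity of the order decides which of the two functions occurs in the Lagrange
  remainder; one bound covers both.\<close>

lemma cosh_sinh_le_cosh_1:
  assumes "\<bar>t::real\<bar> \<le> y" "y \<le> 1"
  shows "\<bar>(if b then cosh else sinh) t\<bar> \<le> cosh 1"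
proof -
  have "\<bar>sinh t\<bar> \<le> cosh \<bar>t\<bar>"
    using sinh_le_cosh_real[of "\<bar>t\<bar>"] by simp
  moreover have "cosh \<bar>t\<bar> \<le> cosh (1::real)"
    using assms by (subst cosh_real_nonneg_le_iff) auto
  ultimately show ?thesis by auto
qed

lemma maclaurin_cosh_bound:
  fixes y :: real
  assumes "0 \<le> y" "y \<le> 1"
  shows "\<bar>cosh y - (\<Sum>m<n. (if even m then 1 else 0) / fact m * y ^ m)\<bar> \<le> cosh 1 * y ^ n"
proof -
  from Maclaurin_all_le[OF _ cosh_sinh_derivs(1), of cosh y n]
  obtain t where t: "\<bar>t\<bar> \<le> \<bar>y\<bar>"
    "cosh y = (\<Sum>m<n. (if even m then cosh else sinh) 0 / fact m * y ^ m)
      + (if even n then cosh else sinh) t / fact n * y ^ n" by auto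
  have "(\<Sum>m<n. (if even m then cosh else sinh) 0 / fact m * y ^ m)
      = (\<Sum>m<n. (if even m then 1 else 0) / fact m * y ^ m)"
    by (intro sum.cong) auto
  with t have "\<bar>cosh y - (\<Sum>m<n. (if even m then 1 else 0) / fact m * y ^ m)\<bar>
      = \<bar>(if even n then cosh else sinh) t\<bar> / fact n * y ^ n"
    using assms by (simp add: abs_mult)
  also have "\<dots> \<le> cosh 1 / 1 * y ^ n"
    using t assms
    by (intro mult_right_mono frac_le cosh_sinh_le_cosh_1[of t y]) auto
  finally show ?thesis by simp
qed

lemma maclaurin_sinh_bound:
  fixes y :: real
  assumes "0 \<le> y" "y \<le> 1"
  shows "\<bar>sinh y - (\<Sum>m<n. (if even m then 0 else 1) / fact m * y ^ m)\<bar> \<le> cosh 1 * y ^ n"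
proof -
  from Maclaurin_all_le[OF _ cosh_sinh_derivs(2), of sinh y n]
  obtain t where t: "\<bar>t\<bar> \<le> \<bar>y\<bar>"
    "sinh y = (\<Sum>m<n. (if even m then sinh else cosh) 0 / fact m * y ^ m)
      + (if odd n then cosh else sinh) t / fact n * y ^ n" by auto
  have "(\<Sum>m<n. (if even m then sinh else cosh) 0 / fact m * y ^ m)
      = (\<Sum>m<n. (if even m then 0 else 1) / fact m * y ^ m)"
    by (intro sum.cong) auto
  with t have "\<bar>sinh y - (\<Sum>m<n. (if even m then 0 else 1) / fact m * y ^ m)\<bar>
      = \<bar>(if odd n then cosh else sinh) t\<bar> / fact n * y ^ n"
    using assms by (simp add: abs_mult)
  also have "\<dots> \<le> cosh 1 / 1 * y ^ n"
    using t assms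
    by (intro mult_right_mono frac_le cosh_sinh_le_cosh_1[of t y]) auto
  finally show ?thesis by simp
qed

section \<open>Order of the Galerkin error\<close>

definition admissible :: "nat \<Rightarrow> nat \<Rightarrow> (nat \<Rightarrow> nat) \<Rightarrow> bool" where
  "admissible N M p \<longleftrightarrow> M = N \<and> (\<forall>i\<le>M. p i = 2 * i) \<or> M = 2 * N \<and> (\<forall>i\<le>M. p i = i)"

lemma admissible_inj: "admissible N M p \<Longrightarrow> inj_on p {..M}"
  by (auto simp: admissible_def inj_on_def)

lemma admissible_0: "admissible N M p \<Longrightarrow> p 0 = 0"
  by (auto simp: admissible_def)

text \<open>Rewrites a Taylor sum with even terms only as a sum over either family of exponents, so
  that the Taylor polynomial of degree \<open>2 * N\<close> becomes a trial function.\<close>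

lemma admissible_sum:
  fixes f :: "nat \<Rightarrow> real"
  assumes "admissible N M p" and odd: "\<And>m. odd m \<Longrightarrow> f m = 0"
  shows "(\<Sum>i\<le>M. f (p i)) = (\<Sum>m<Suc (2 * N). f m)"
proof -
  have "(\<Sum>i\<le>K. f (2 * i)) = (\<Sum>m<Suc (2 * K). f m)" for K
    by (induction K) (simp_all add: odd)
  then show ?thesis
    using assms(1) unfolding admissible_def lessThan_Suc_atMost by auto
qed

text \<open>Follows from
  \<open>x (cosh x - sinh x) = x exp (-x) \<le> x \<le> sinh x\<close>.\<close>

lemma x_coth_le:
  assumes "x > 0"
  shows "x * coth x \<le> 1 + x"
proof -
  have "x \<le> sinh x" using real_le_x_sinh[of x] assms by (simp add: sinh_field_def exp_minus)
  have "x * (cosh x - sinh x) \<le> x * 1"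
    unfolding cosh_minus_sinh using assms by (intro mult_left_mono) auto
  with \<open>x \<le> sinh x\<close> have "x * cosh x \<le> (1 + x) * sinh x" by (simp add: algebra_simps)
  then show ?thesis using assms by (simp add: coth_def divide_le_eq)
qed

text \<open>The function \<open>sinh x - x cosh x\<close> is 0 at 0 and has derivative
  \<open>- x sinh x\<close>.\<close>

lemma x_coth_ge:
  assumes "x > 0"
  shows "1 \<le> x * coth x"
proof -
  have "sinh x - x * cosh x \<le> sinh 0 - 0 * cosh (0::real)"
    using assms by (intro DERIV_nonpos_imp_nonincreasing[where f = "\<lambda>x. sinh x - x * cosh x"])
      (auto intro!: derivative_eq_intros exI)
  then show ?thesis using assms by (simp add: coth_def le_divide_eq)
qed

text \<open>For \<open>x > 1\<close> the two-sided bounds already give a difference of at most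
  \<open>x\<close>. For \<open>x \<le> 1\<close> the Taylor polynomial approximates \<open>u\<close>
  and \<open>u'\<close> up to \<open>cosh 1 * x ^ (2 * N)\<close>; squaring and the outer factor
  \<open>x^2\<close> produce the exponent \<open>4 * N + 2\<close>.\<close>

lemma galerkin_rate:
  assumes adm: "admissible N M p" and x: "x > 0"
  shows "x * coth x - galerkin x M p \<le> 2 * (cosh 1)\<^sup>2 * x ^ (4 * N + 2)"
proof (cases "x \<le> 1")
  case False
  have "1 \<le> galerkin x M p"
    by (rule galerkin_ge[OF admissible_inj[OF adm] x admissible_0[OF adm]])
  then have "x * coth x - galerkin x M p \<le> x ^ 1" using x_coth_le[OF x] by simp
  also have "\<dots> \<le> x ^ (4 * N + 2)" using False by (intro power_increasing) auto
  also have "\<dots> \<le> 2 * (cosh 1)\<^sup>2 * x ^ (4 * N + 2)"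
    using x one_le_power[OF cosh_real_ge_1[of 1], of 2] by simp
  finally show ?thesis .
next
  case x1: True
  define s where "s = x * sinh x"
  \<comment> \<open>Taylor coefficients of \<open>cosh (x z) / (x sinh x)\<close> in \<open>z\<close>.\<close>
  define d where "d m = (if even m then x ^ m / fact m else 0) / s" for m
  define c where "c i = d (p i)" for i
  have xs: "x \<le> sinh x" using real_le_x_sinh[of x] x by (simp add: sinh_field_def exp_minus)
  have s: "x\<^sup>2 \<le> s" "s > 0" using x xs by (auto simp: s_def power2_eq_square)
  have bu: "\<bar>cosh (x * z) / s - trial p M c z\<bar> \<le> cosh 1 * x ^ (2 * N)" if z: "0 \<le> z" "z \<le> 1" for z
  proof -
    have xz: "0 \<le> x * z" "x * z \<le> x" "x * z \<le> 1"
      using x x1 z mult_left_le[of z x] order_trans[OF mult_left_le[of z x] x1] by auto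
    have "trial p M c z = (\<Sum>m<Suc (2 * N). d m * z ^ m)"
      using admissible_sum[OF adm, of "\<lambda>m. d m * z ^ m"] by (simp add: trial_def c_def d_def)
    \<comment> \<open>The term of odd degree \<open>2 * N + 1\<close> is zero. Including it raises
      the order of the remainder to \<open>2 * N + 2\<close>, which offsets the division by
      \<open>s \<ge> x^2\<close>.\<close>
    also have "\<dots> = (\<Sum>m<2 * N + 2. d m * z ^ m)" by (simp add: d_def)
    also have "\<dots> = (\<Sum>m<2 * N + 2. (if even m then 1 else 0) / fact m * (x * z) ^ m) / s"
      unfolding sum_divide_distrib by (intro sum.cong) (auto simp: d_def power_mult_distrib)
    finally have "\<bar>cosh (x * z) / s - trial p M c z\<bar>
        = \<bar>cosh (x * z) - (\<Sum>m<2 * N + 2. (if even m then 1 else 0) / fact m * (x * z) ^ m)\<bar> / s"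
      using s by (simp add: diff_divide_distrib[symmetric])
    also have "\<dots> \<le> cosh 1 * (x * z) ^ (2 * N + 2) / x\<^sup>2"
      using xz x1 x s by (intro frac_le maclaurin_cosh_bound) auto
    also have "\<dots> \<le> cosh 1 * x ^ (2 * N + 2) / x\<^sup>2"
      using xz by (intro divide_right_mono mult_left_mono power_mono) auto
    also have "\<dots> = cosh 1 * x ^ (2 * N)" using x by (simp add: power2_eq_square)
    finally show ?thesis .
  qed
  have bd: "\<bar>sinh (x * z) / sinh x - trial_deriv p M c z\<bar> \<le> cosh 1 * x ^ (2 * N)" if z: "0 \<le> z" "z \<le> 1" for z
  proof -
    have xz: "0 \<le> x * z" "x * z \<le> x" "x * z \<le> 1"
      using x x1 z mult_left_le[of z x] order_trans[OF mult_left_le[of z x] x1] by auto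
    have "trial_deriv p M c z = (\<Sum>m<Suc (2 * N). d m * (real m * z ^ (m - 1)))"
      using admissible_sum[OF adm, of "\<lambda>m. d m * (real m * z ^ (m - 1))"]
      by (simp add: trial_deriv_def c_def d_def)
    also have "\<dots> = (\<Sum>m<2 * N. d (Suc m) * (real (Suc m) * z ^ m))"
      by (subst sum.lessThan_Suc_shift) simp
    also have "\<dots> = (\<Sum>m<2 * N. (if even m then 0 else 1) / fact m * (x * z) ^ m) / sinh x"
      unfolding sum_divide_distrib using x xs
      by (intro sum.cong) (auto simp: d_def s_def power_mult_distrib fact_Suc simp del: of_nat_Suc)
    \<comment> \<open>Again a vanishing term, of even degree \<open>2 * N\<close>, is added to gain
      one order against the division by \<open>sinh x \<ge> x\<close>.\<close>
    also have "\<dots> = (\<Sum>m<2 * N + 1. (if even m then 0 else 1) / fact m * (x * z) ^ m) / sinh x"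
      by simp
    finally have "\<bar>sinh (x * z) / sinh x - trial_deriv p M c z\<bar>
        = \<bar>sinh (x * z) - (\<Sum>m<2 * N + 1. (if even m then 0 else 1) / fact m * (x * z) ^ m)\<bar> / sinh x"
      using x by (simp add: diff_divide_distrib[symmetric])
    also have "\<dots> \<le> cosh 1 * (x * z) ^ (2 * N + 1) / x"
      using xz x1 x xs by (intro frac_le maclaurin_sinh_bound) auto
    also have "\<dots> \<le> cosh 1 * x ^ (2 * N + 1) / x"
      using xz x by (intro divide_right_mono mult_left_mono power_mono) auto
    also have "\<dots> = cosh 1 * x ^ (2 * N)" using x by simp
    finally show ?thesis .
  qed
  let ?E = "2 * (cosh 1 * x ^ (2 * N))\<^sup>2"
  have "coth x / x - 2 * (\<Sum>i\<le>M. c i) + (\<Sum>i\<le>M. \<Sum>j\<le>M. c i * c j * gram x M p $$ (i, j)) \<le> ?E"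
  proof (rule has_integral_le[OF error_energy[OF x]])
    show "((\<lambda>z. ?E) has_integral ?E) {0..1::real}"
      using has_integral_const_real[of ?E 0 1] by simp
    fix z :: real assume "z \<in> {0..1}"
    then have "(cosh (x * z) / (x * sinh x) - trial p M c z)\<^sup>2 \<le> (cosh 1 * x ^ (2 * N))\<^sup>2"
      "(sinh (x * z) / sinh x - trial_deriv p M c z)\<^sup>2 \<le> (cosh 1 * x ^ (2 * N))\<^sup>2"
      using bu[of z] bd[of z] by (auto simp: s_def intro!: abs_le_square_iff[THEN iffD1])
    moreover have "x\<^sup>2 \<le> 1" using x x1 by (simp add: power_le_one)
    ultimately have "x\<^sup>2 * (cosh (x * z) / (x * sinh x) - trial p M c z)\<^sup>2 \<le> 1 * (cosh 1 * x ^ (2 * N))\<^sup>2"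
      by (intro mult_mono) auto
    with \<open>(sinh (x * z) / sinh x - trial_deriv p M c z)\<^sup>2 \<le> _\<close>
    show "x\<^sup>2 * (cosh (x * z) / (x * sinh x) - trial p M c z)\<^sup>2
      + (sinh (x * z) / sinh x - trial_deriv p M c z)\<^sup>2 \<le> ?E" by simp
  qed
  then have "x * coth x - galerkin x M p \<le> x\<^sup>2 * ?E"
    by (intro order_trans[OF galerkin_error[OF admissible_inj[OF adm] x, of c]] mult_left_mono) auto
  also have "\<dots> = 2 * (cosh 1)\<^sup>2 * (x\<^sup>2 * (x ^ (2 * N))\<^sup>2)"
    by (simp only: power_mult_distrib mult_ac)
  also have "x\<^sup>2 * (x ^ (2 * N))\<^sup>2 = x ^ (2 + 2 * N * 2)"
    by (simp only: power_add power_mult)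
  also have "2 + 2 * N * 2 = 4 * N + 2"
    by simp
  finally show ?thesis .
qed

subsection \<open>Phase speeds\<close>

text \<open>Makes \<open>Lim\<close> at the origin well determined: every neighbourhood of the
  origin contains other points of the first coordinate axis, which exists as
  \<open>n \<ge> 1\<close>.\<close>

lemma Euclidean_space_atin_origin_nontrivial:
  assumes "n \<ge> 1"
  shows "atin (Euclidean_space n) (\<lambda>_. 0) \<noteq> bot"
proof
  assume "atin (Euclidean_space n) (\<lambda>_. 0) = bot"
  then have "eventually (\<lambda>_. False) (atin (Euclidean_space n) (\<lambda>_. 0))"
    by simp
  then obtain U where U: "openin (Euclidean_space n) U" "(\<lambda>_. 0) \<in> U" "U - {\<lambda>_. 0} = {}"
    by (auto simp: eventually_atin topspace_Euclidean_space)
  let ?\<phi> = "\<lambda>t i. if i < n then if i = 0 then t else 0 else 0 :: real"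
  have "continuous_map euclideanreal (Euclidean_space n) ?\<phi>"
    unfolding continuous_map_componentwise_Euclidean_space by auto
  from openin_continuous_map_preimage[OF this U(1)] have "open {t. ?\<phi> t \<in> U}"
    by simp
  moreover have "?\<phi> 0 = (\<lambda>_. 0)"
    by auto
  then have "0 \<in> {t. ?\<phi> t \<in> U}"
    using U(2) by simp
  ultimately obtain e where e: "e > 0" "ball 0 e \<subseteq> {t. ?\<phi> t \<in> U}"
    by (meson open_contains_ball)
  then have "?\<phi> (e / 2) \<in> U"
    by (auto simp: subset_iff dist_norm)
  with U(3) have "?\<phi> (e / 2) = (\<lambda>_. 0)"
    by blast
  from fun_cong[OF this, of 0] show False
    using assms e by simp
qed

lemma euclid_norm_nonneg: "0 \<le> euclid_norm n \<xi>"
  by (simp add: euclid_norm_def)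

lemma euclid_norm_eq_0_iff:
  assumes "\<xi> \<in> topspace (Euclidean_space n)"
  shows "euclid_norm n \<xi> = 0 \<longleftrightarrow> \<xi> = (\<lambda>_. 0)"
  using assms by (auto simp: euclid_norm_def L2_set_eq_0_iff topspace_Euclidean_space fun_eq_iff)
    (meson lessThan_iff not_le)

lemma euclid_norm_scale: "c \<ge> 0 \<Longrightarrow> euclid_norm n (\<lambda>i. c * \<xi> i) = c * euclid_norm n \<xi>"
  by (simp add: euclid_norm_def L2_set_right_distrib)

text \<open>The target is \<open>at_right 0\<close>, so that limits of profiles known only for
  positive wave numbers can be composed with the norm.\<close>

lemma filterlim_euclid_norm:
  "filterlim (euclid_norm n) (at_right 0) (atin (Euclidean_space n) (\<lambda>_. 0))"
proof -
  let ?F = "atin (Euclidean_space n) (\<lambda>_. 0)"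
  have top: "(\<lambda>_. 0) \<in> topspace (Euclidean_space n)"
    by (simp add: topspace_Euclidean_space)
  have "((\<lambda>\<xi>. \<xi> i) \<longlongrightarrow> 0) ?F" for i :: nat
  proof -
    have "continuous_map (Euclidean_space n) euclideanreal (\<lambda>\<xi>. \<xi> i)"
      unfolding Euclidean_space_def
      by (intro continuous_map_from_subtopology continuous_map_product_coordinates) simp
    from limitin_continuous_map[OF this top refl] show ?thesis by simp
  qed
  then have "((\<lambda>\<xi>. sqrt (\<Sum>i<n. (\<xi> i)\<^sup>2)) \<longlongrightarrow> sqrt (\<Sum>i<n. 0\<^sup>2)) ?F"
    by (intro tendsto_intros)
  then have "(euclid_norm n \<longlongrightarrow> 0) ?F"
    by (simp add: euclid_norm_def[abs_def] L2_set_def)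
  moreover have "eventually (\<lambda>\<xi>. euclid_norm n \<xi> > 0) ?F"
    unfolding eventually_atin
  proof (intro disjI2 exI conjI ballI)
    show "openin (Euclidean_space n) (topspace (Euclidean_space n))" by simp
    show "(\<lambda>_. 0) \<in> topspace (Euclidean_space n)" by (rule top)
    show "euclid_norm n \<xi> > 0" if "\<xi> \<in> topspace (Euclidean_space n) - {\<lambda>_. 0}" for \<xi>
      using that euclid_norm_nonneg[of n \<xi>] euclid_norm_eq_0_iff[of \<xi> n] by auto
  qed
  ultimately show ?thesis
    by (auto simp: filterlim_at elim: eventually_mono)
qed

text \<open>Replaces the limit at the origin by a one-sided limit of the radial profile
  \<open>F\<close>.\<close>

lemma cont_extension_radial:
  assumes n: "n \<ge> 1" and \<xi>: "\<xi> \<in> topspace (Euclidean_space n)"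
    and f: "\<And>\<eta>. euclid_norm n \<eta> > 0 \<Longrightarrow> f \<eta> = F (euclid_norm n \<eta>)"
    and F: "(F \<longlongrightarrow> l) (at_right 0)"
  shows "cont_extension_at_origin n f \<xi> = (if euclid_norm n \<xi> = 0 then l else F (euclid_norm n \<xi>))"
proof (cases "\<xi> = (\<lambda>_. 0)")
  case False
  then show ?thesis
    using f[of \<xi>] euclid_norm_eq_0_iff[OF \<xi>] euclid_norm_nonneg[of n \<xi>]
    by (simp add: cont_extension_at_origin_def)
next
  case True
  let ?A = "atin (Euclidean_space n) (\<lambda>_. 0)"
  have "eventually (\<lambda>\<eta>. euclid_norm n \<eta> > 0) ?A"
    using filterlim_euclid_norm[of n] by (auto simp: filterlim_at elim: eventually_mono)
  then have "eventually (\<lambda>\<eta>. F (euclid_norm n \<eta>) = f \<eta>) ?A"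
    by (rule eventually_mono) (simp add: f)
  with filterlim_compose[OF F filterlim_euclid_norm[of n]]
  have "(f \<longlongrightarrow> l) ?A"
    by (rule Lim_transform_eventually)
  then have "Lim ?A f = l"
    by (rule tendsto_Lim[OF Euclidean_space_atin_origin_nontrivial[OF n]])
  then show ?thesis
    using True euclid_norm_eq_0_iff[OF \<xi>] by (simp add: cont_extension_at_origin_def)
qed

section \<open>Speeds as functions of the wave number\<close>

text \<open>Common form of both squared speeds: \<open>\<Phi>\<close> and \<open>\<Psi>\<close> are
  \<open>x * coth x\<close> for the full problem and \<open>galerkin\<close> for the Kakinuma model.
  Replacing both by 1 gives \<open>c_SW_sq\<close>.\<close>

definition layer_speed :: "real \<Rightarrow> real \<Rightarrow> real \<Rightarrow> real \<Rightarrow> real \<Rightarrow> (real \<Rightarrow> real) \<Rightarrow> (real \<Rightarrow> real) \<Rightarrow> real \<Rightarrow> real" where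
  "layer_speed \<rho>1 \<rho>2 h1 h2 g \<Phi> \<Psi> k =
     (\<rho>2 - \<rho>1) * g / (\<rho>1 / h1 * \<Phi> (h1 * k) + \<rho>2 / h2 * \<Psi> (h2 * k))"

lemma layer_speed_tendsto:
  assumes h: "h1 > 0" "h2 > 0" and \<rho>: "\<rho>1 > 0" "\<rho>2 > 0"
    and \<Phi>: "\<And>x. x > 0 \<Longrightarrow> 1 \<le> \<Phi> x \<and> \<Phi> x \<le> 1 + x"
    and \<Psi>: "\<And>x. x > 0 \<Longrightarrow> 1 \<le> \<Psi> x \<and> \<Psi> x \<le> 1 + x"
  shows "(layer_speed \<rho>1 \<rho>2 h1 h2 g \<Phi> \<Psi> \<longlongrightarrow> c_SW_sq \<rho>1 \<rho>2 h1 h2 g) (at_right 0)"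
proof -
  have lim: "((\<lambda>k. X (h * k)) \<longlongrightarrow> 1) (at_right 0)"
    if X: "\<And>x. x > 0 \<Longrightarrow> 1 \<le> X x \<and> X x \<le> 1 + x" and "h > 0" for X :: "real \<Rightarrow> real" and h
  proof (rule tendsto_sandwich[where f = "\<lambda>_. 1" and h = "\<lambda>k. 1 + h * k"])
    have pos: "eventually (\<lambda>k. 0 < k) (at_right (0::real))"
      by (rule eventually_at_right_less)
    show "eventually (\<lambda>k. 1 \<le> X (h * k)) (at_right 0)"
      by (rule eventually_mono[OF pos]) (use X \<open>h > 0\<close> in auto)
    show "eventually (\<lambda>k. X (h * k) \<le> 1 + h * k) (at_right 0)"
      by (rule eventually_mono[OF pos]) (use X \<open>h > 0\<close> in auto)
    show "((\<lambda>k. 1 + h * k) \<longlongrightarrow> 1) (at_right 0)"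
      by (auto intro!: tendsto_eq_intros)
  qed simp
  have "\<rho>1 / h1 * 1 + \<rho>2 / h2 * 1 > 0"
    using h \<rho> by (simp add: add_pos_pos)
  then have "(layer_speed \<rho>1 \<rho>2 h1 h2 g \<Phi> \<Psi> \<longlongrightarrow> (\<rho>2 - \<rho>1) * g / (\<rho>1 / h1 * 1 + \<rho>2 / h2 * 1)) (at_right 0)"
    unfolding layer_speed_def[abs_def]
    by (intro tendsto_intros lim \<Phi> \<Psi> h) auto
  moreover have "(\<rho>2 - \<rho>1) * g / (\<rho>1 / h1 * 1 + \<rho>2 / h2 * 1) = c_SW_sq \<rho>1 \<rho>2 h1 h2 g"
    using h by (simp add: c_SW_sq_def add_frac_eq)
  ultimately show ?thesis by simp
qed

text \<open>After division by \<open>c_SW_sq\<close> the speeds are \<open>(a + b) / s\<close> and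
  \<open>(a + b) / t\<close> with \<open>s \<ge> t \<ge> a + b\<close>. Their distance
  \<open>(a + b) (s - t) / (s t)\<close> is at most \<open>(s - t) / (a + b)\<close>, and the
  weights \<open>a\<close>, \<open>b\<close> cancel.\<close>

lemma layer_speed_diff:
  assumes h: "h1 > 0" "h2 > 0" and \<rho>: "0 < \<rho>1" "\<rho>1 < \<rho>2" and g: "g > 0" and k: "k > 0"
    and \<Phi>: "1 \<le> \<Phi>' (h1 * k)" "\<Phi>' (h1 * k) \<le> \<Phi> (h1 * k)" "\<Phi> (h1 * k) - \<Phi>' (h1 * k) \<le> D"
    and \<Psi>: "1 \<le> \<Psi>' (h2 * k)" "\<Psi>' (h2 * k) \<le> \<Psi> (h2 * k)" "\<Psi> (h2 * k) - \<Psi>' (h2 * k) \<le> D"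
  shows "\<bar>layer_speed \<rho>1 \<rho>2 h1 h2 g \<Phi> \<Psi> k / c_SW_sq \<rho>1 \<rho>2 h1 h2 g
    - layer_speed \<rho>1 \<rho>2 h1 h2 g \<Phi>' \<Psi>' k / c_SW_sq \<rho>1 \<rho>2 h1 h2 g\<bar> \<le> D"
proof -
  define a where "a = \<rho>1 / h1"
  define b where "b = \<rho>2 / h2"
  define G where "G = (\<rho>2 - \<rho>1) * g"
  define s where "s = a * \<Phi> (h1 * k) + b * \<Psi> (h2 * k)"
  define t where "t = a * \<Phi>' (h1 * k) + b * \<Psi>' (h2 * k)"
  have a: "a > 0" and b: "b > 0" and G: "G > 0"
    using assms by (auto simp: a_def b_def G_def)
  have c: "c_SW_sq \<rho>1 \<rho>2 h1 h2 g = G / (a + b)"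
    using h by (simp add: c_SW_sq_def G_def a_def b_def add_frac_eq)
  have "a * 1 \<le> a * \<Phi>' (h1 * k)" "b * 1 \<le> b * \<Psi>' (h2 * k)"
    using a b \<Phi>(1) \<Psi>(1) by (auto intro: mult_left_mono)
  then have t: "a + b \<le> t"
    by (simp only: t_def mult_1_right add_mono)
  have st: "t \<le> s"
    unfolding t_def s_def using a b \<Phi>(2) \<Psi>(2) by (intro add_mono mult_left_mono) auto
  have D: "s - t \<le> (a + b) * D"
    using mult_left_mono[OF \<Phi>(3), of a] mult_left_mono[OF \<Psi>(3), of b] a b
    by (simp add: t_def s_def algebra_simps)
  have "layer_speed \<rho>1 \<rho>2 h1 h2 g \<Phi> \<Psi> k / c_SW_sq \<rho>1 \<rho>2 h1 h2 g
    - layer_speed \<rho>1 \<rho>2 h1 h2 g \<Phi>' \<Psi>' k / c_SW_sq \<rho>1 \<rho>2 h1 h2 g = (a + b) / s - (a + b) / t"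
    using G by (simp add: c layer_speed_def G_def[symmetric] a_def[symmetric] b_def[symmetric]
        s_def[symmetric] t_def[symmetric])
  also have "\<dots> = - ((a + b) * (s - t) / (s * t))"
    using a b t st by (simp add: field_simps)
  finally have "\<bar>layer_speed \<rho>1 \<rho>2 h1 h2 g \<Phi> \<Psi> k / c_SW_sq \<rho>1 \<rho>2 h1 h2 g
    - layer_speed \<rho>1 \<rho>2 h1 h2 g \<Phi>' \<Psi>' k / c_SW_sq \<rho>1 \<rho>2 h1 h2 g\<bar> = (a + b) * (s - t) / (s * t)"
    using a b t st by simp
  also have "\<dots> \<le> (a + b) * ((a + b) * D) / ((a + b) * (a + b))"
  proof (rule frac_le)
    have "0 \<le> D" using \<Phi>(2,3) by linarith
    then show "0 \<le> (a + b) * ((a + b) * D)" using a b by simp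
    show "(a + b) * (s - t) \<le> (a + b) * ((a + b) * D)"
      using a b D by (intro mult_left_mono) auto
    show "0 < (a + b) * (a + b)" using a b by simp
    show "(a + b) * (a + b) \<le> s * t" using a b t st by (intro mult_mono) auto
  qed
  also have "\<dots> = D"
    using a b by simp
  finally show ?thesis .
qed

lemma c_IW_sq_eq:
  assumes n: "n \<ge> 1" and \<xi>: "\<xi> \<in> topspace (Euclidean_space n)"
    and h: "h1 > 0" "h2 > 0" and \<rho>: "\<rho>1 > 0" "\<rho>2 > 0"
  shows "c_IW_sq n \<rho>1 \<rho>2 h1 h2 g \<xi> = (if euclid_norm n \<xi> = 0 then c_SW_sq \<rho>1 \<rho>2 h1 h2 g
    else layer_speed \<rho>1 \<rho>2 h1 h2 g (\<lambda>x. x * coth x) (\<lambda>x. x * coth x) (euclid_norm n \<xi>))"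
  unfolding c_IW_sq_def
proof (rule cont_extension_radial[OF n \<xi>])
  show "(let k = euclid_norm n \<eta> in (\<rho>2 - \<rho>1) * g / (\<rho>1 * k * coth (h1 * k) + \<rho>2 * k * coth (h2 * k)))
    = layer_speed \<rho>1 \<rho>2 h1 h2 g (\<lambda>x. x * coth x) (\<lambda>x. x * coth x) (euclid_norm n \<eta>)" for \<eta>
    using h by (simp add: Let_def layer_speed_def)
  show "(layer_speed \<rho>1 \<rho>2 h1 h2 g (\<lambda>x. x * coth x) (\<lambda>x. x * coth x)
      \<longlongrightarrow> c_SW_sq \<rho>1 \<rho>2 h1 h2 g) (at_right 0)"
    by (rule layer_speed_tendsto[OF h \<rho>]) (simp_all add: x_coth_le x_coth_ge)
qed

lemma calA1_eq_gram: "calA1 n N \<xi> = gram (euclid_norm n \<xi>) N (\<lambda>i. 2 * i)"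
  by (auto simp: calA1_def gram_def A10_def A11_def A20_def A21_def algebra_simps intro!: eq_matI)

lemma calA2_eq_gram: "calA2 n M p \<xi> = gram (euclid_norm n \<xi>) M p"
  by (simp add: calA2_def gram_def)

lemma c_K_sq_eq:
  assumes n: "n \<ge> 1" and \<xi>: "\<xi> \<in> topspace (Euclidean_space n)"
    and h: "h1 > 0" "h2 > 0" and \<rho>: "\<rho>1 > 0" "\<rho>2 > 0" and adm: "admissible N M p"
  shows "c_K_sq n N M p \<rho>1 \<rho>2 h1 h2 g \<xi> = (if euclid_norm n \<xi> = 0 then c_SW_sq \<rho>1 \<rho>2 h1 h2 g
    else layer_speed \<rho>1 \<rho>2 h1 h2 g (\<lambda>x. galerkin x N (\<lambda>i. 2 * i)) (\<lambda>x. galerkin x M p) (euclid_norm n \<xi>))"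
  unfolding c_K_sq_def
proof (rule cont_extension_radial[OF n \<xi>])
  have adm1: "admissible N N (\<lambda>i. 2 * i)"
    by (simp add: admissible_def)
  show "(layer_speed \<rho>1 \<rho>2 h1 h2 g (\<lambda>x. galerkin x N (\<lambda>i. 2 * i)) (\<lambda>x. galerkin x M p)
      \<longlongrightarrow> c_SW_sq \<rho>1 \<rho>2 h1 h2 g) (at_right 0)"
    using adm adm1
    by (intro layer_speed_tendsto[OF h \<rho>] conjI galerkin_ge order_trans[OF galerkin_le x_coth_le]
        admissible_inj admissible_0) auto
  fix \<eta> assume k0: "euclid_norm n \<eta> > 0"
  define k where "k = euclid_norm n \<eta>"
  have k: "k > 0" using k0 by (simp add: k_def)
  define M1 where "M1 = gram (h1 * k) N (\<lambda>i. 2 * i)"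
  define M2 where "M2 = gram (h2 * k) M p"
  have d: "det M1 \<noteq> 0" "det M2 \<noteq> 0"
    unfolding M1_def M2_def using h k
    by (simp_all only: det_gram_nonzero admissible_inj[OF adm1] admissible_inj[OF adm] mult_pos_pos not_False_eq_True)
  let ?q1 = "det (bordered M1) / det M1" and ?q2 = "det (bordered M2) / det M2"
  \<comment> \<open>Both determinants are nonzero for \<open>k > 0\<close>, so their product cancels
    and only the ratios \<open>?q1\<close> and \<open>?q2\<close> remain.\<close>
  have "\<rho>1 * h1 * det (bordered M1) * det M2 + \<rho>2 * h2 * det (bordered M2) * det M1
      = (det M1 * det M2) * (\<rho>1 * h1 * ?q1 + \<rho>2 * h2 * ?q2)"
    using d by (simp add: field_simps)
  then have "(\<rho>2 - \<rho>1) * g * inverse (k\<^sup>2) * det M1 * det M2 /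
     (\<rho>1 * h1 * det (bordered M1) * det M2 + \<rho>2 * h2 * det (bordered M2) * det M1)
     = ((\<rho>2 - \<rho>1) * g * inverse (k\<^sup>2)) * (det M1 * det M2) / ((\<rho>1 * h1 * ?q1 + \<rho>2 * h2 * ?q2) * (det M1 * det M2))"
    by (simp only: mult_ac)
  also have "\<dots> = ((\<rho>2 - \<rho>1) * g * inverse (k\<^sup>2)) / (\<rho>1 * h1 * ?q1 + \<rho>2 * h2 * ?q2)"
    by (rule mult_divide_mult_cancel_right) (use d in simp)
  also have "\<dots> = (\<rho>2 - \<rho>1) * g / (k\<^sup>2 * (\<rho>1 * h1 * ?q1 + \<rho>2 * h2 * ?q2))"
    by (simp add: divide_inverse mult_ac)
  also have "k\<^sup>2 * (\<rho>1 * h1 * ?q1 + \<rho>2 * h2 * ?q2)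
      = \<rho>1 / h1 * ((h1 * k)\<^sup>2 * ?q1) + \<rho>2 / h2 * ((h2 * k)\<^sup>2 * ?q2)"
    using h by (simp add: power2_eq_square algebra_simps)
  finally show "(let M1 = calA1 n N (\<lambda>i. h1 * \<eta> i); M2 = calA2 n M p (\<lambda>i. h2 * \<eta> i) in
     (\<rho>2 - \<rho>1) * g * inverse ((euclid_norm n \<eta>)\<^sup>2) * det M1 * det M2 /
     (\<rho>1 * h1 * det (bordered M1) * det M2 + \<rho>2 * h2 * det (bordered M2) * det M1))
     = layer_speed \<rho>1 \<rho>2 h1 h2 g (\<lambda>x. galerkin x N (\<lambda>i. 2 * i)) (\<lambda>x. galerkin x M p) (euclid_norm n \<eta>)"
    using h unfolding Let_def calA1_eq_gram calA2_eq_gram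
    by (simp add: euclid_norm_scale k_def[symmetric] M1_def[symmetric] M2_def[symmetric] layer_speed_def galerkin_def)
qed

theorem theorem3p2:
  fixes N :: nat
  shows "\<exists>C>0. \<forall>n \<rho>1 \<rho>2 h1 h2 g Nstar (p :: nat \<Rightarrow> nat). \<forall>\<xi> \<in> topspace (Euclidean_space n).
    n \<ge> 1 \<longrightarrow> \<rho>2 > \<rho>1 \<longrightarrow> \<rho>1 > 0 \<longrightarrow> h1 > 0 \<longrightarrow> h2 > 0 \<longrightarrow> g > 0 \<longrightarrow>
    ((Nstar = N \<and> (\<forall>i\<le>Nstar. p i = 2 * i)) \<or> (Nstar = 2 * N \<and> (\<forall>i\<le>Nstar. p i = i))) \<longrightarrow>
    \<bar>c_IW_sq n \<rho>1 \<rho>2 h1 h2 g \<xi> / c_SW_sq \<rho>1 \<rho>2 h1 h2 g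
       - c_K_sq n N Nstar p \<rho>1 \<rho>2 h1 h2 g \<xi> / c_SW_sq \<rho>1 \<rho>2 h1 h2 g\<bar>
      \<le> C * (h1 * euclid_norm n \<xi> + h2 * euclid_norm n \<xi>) ^ (4 * N + 2)"
proof (intro exI[of _ "2 * (cosh 1)\<^sup>2"] conjI allI ballI impI)
  \<comment> \<open>The constant is the one of \<open>galerkin_rate\<close>; it does not even
    involve \<open>N\<close>.\<close>
  show "0 < 2 * (cosh 1 :: real)\<^sup>2" by simp
  fix n :: nat and \<rho>1 \<rho>2 h1 h2 g :: real and M :: nat and p :: "nat \<Rightarrow> nat" and \<xi>
  assume \<xi>: "\<xi> \<in> topspace (Euclidean_space n)" and n: "1 \<le> n"
    and \<rho>: "\<rho>1 < \<rho>2" "0 < \<rho>1" and h: "0 < h1" "0 < h2" and g: "0 < g"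
    and adm: "(M = N \<and> (\<forall>i\<le>M. p i = 2 * i)) \<or> (M = 2 * N \<and> (\<forall>i\<le>M. p i = i))"
  have adm: "admissible N M p" and adm1: "admissible N N (\<lambda>i. 2 * i)"
    using adm by (simp_all add: admissible_def)
  have \<rho>2: "\<rho>2 > 0" using \<rho> by simp
  define k where "k = euclid_norm n \<xi>"
  note eqs = c_IW_sq_eq[OF n \<xi> h \<rho>(2) \<rho>2] c_K_sq_eq[OF n \<xi> h \<rho>(2) \<rho>2 adm]
  show "\<bar>c_IW_sq n \<rho>1 \<rho>2 h1 h2 g \<xi> / c_SW_sq \<rho>1 \<rho>2 h1 h2 g
       - c_K_sq n N M p \<rho>1 \<rho>2 h1 h2 g \<xi> / c_SW_sq \<rho>1 \<rho>2 h1 h2 g\<bar>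
      \<le> 2 * (cosh 1)\<^sup>2 * (h1 * euclid_norm n \<xi> + h2 * euclid_norm n \<xi>) ^ (4 * N + 2)"
  proof (cases "k = 0")
    case True
    \<comment> \<open>At the origin both extensions equal \<open>c_SW_sq\<close>.\<close>
    then show ?thesis by (simp add: eqs k_def)
  next
    case False
    then have k: "k > 0" using euclid_norm_nonneg[of n \<xi>] by (simp add: k_def)
    let ?D = "2 * (cosh 1)\<^sup>2 * (h1 * k + h2 * k) ^ (4 * N + 2)"
    \<comment> \<open>Bounds the rates at \<open>h1 * k\<close> and at \<open>h2 * k\<close> by one
      common \<open>?D\<close>.\<close>
    have mono: "2 * (cosh 1)\<^sup>2 * x ^ (4 * N + 2) \<le> ?D" if "0 \<le> x" "x \<le> h1 * k + h2 * k" for x :: real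
      using that by (intro mult_left_mono power_mono) auto
    have hk: "h1 * k > 0" "h2 * k > 0" using h k by auto
    have "\<bar>layer_speed \<rho>1 \<rho>2 h1 h2 g (\<lambda>x. x * coth x) (\<lambda>x. x * coth x) k / c_SW_sq \<rho>1 \<rho>2 h1 h2 g
      - layer_speed \<rho>1 \<rho>2 h1 h2 g (\<lambda>x. galerkin x N (\<lambda>i. 2 * i)) (\<lambda>x. galerkin x M p) k
        / c_SW_sq \<rho>1 \<rho>2 h1 h2 g\<bar> \<le> ?D"
      using hk
      by (intro layer_speed_diff h \<rho> g k galerkin_ge galerkin_le admissible_inj[OF adm]
          admissible_inj[OF adm1] admissible_0[OF adm] order_trans[OF galerkin_rate mono] adm adm1) auto
    then show ?thesis
      using False by (simp add: eqs k_def)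
  qed
qed

end
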